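(* Let $\mathbf P=\big(P,\leq,({}^z;z\in P),0,1\big)$ be a relatively paraorthomodular mub-complete poset, for $x,y\in P$ let $x\rightarrow y:=\big(\operatorname{Min}U(x,y)\big)^y=\{w^y\mid w\in\operatorname{Min}U(x,y)\}$, and let $x,y\in P$. Then the following hold: (i) $y\leq x\rightarrow y$; (ii) $x\leq y$ if and only if $x\rightarrow y=1$; (iii) $x\rightarrow y=1$ if $x\leq y$; $x\rightarrow y=(x\vee y)^y$ if $x\vee y$ exists; and $x\rightarrow y=x^y$ if $y\leq x$; (iv) $(x\rightarrow y)\rightarrow y=\operatorname{Min}U(x,y)$; (v) $\big((x\rightarrow y)\rightarrow y\big)\rightarrow y=x\rightarrow y$.
   Context: For a poset $(P,\leq)$, $U(x,y)$ is the set of common upper bounds of $x,y$, and $\operatorname{Min}A$ is the set of minimal elements of $A$. $A\leq B$ means $a\leq b$ for all $a\in A,b\in B$; elements are identified with singletons. The operator $\rightarrow\colon P^2\to2^P$ is extended to subsets by $A\rightarrow B:=\bigcup_{a\in A,b\in B}(a\rightarrow b)$. $x\vee y$ denotes the supremum. An antitone involution on a poset is a unary operation ${}'$ with $x''=x$ such that $x\leq y$ implies $y'\leq x'$. A bounded poset $(Q,\leq,{}',0,1)$ with antitone involution is paraorthomodular if $x\leq y$ and $x'\wedge y=0$ together imply $x=y$. A relatively paraorthomodular poset is $\big(P,\leq,({}^x;x\in P),0,1\big)$ where $(P,\leq,0,1)$ is a bounded poset and, for every $x\in P$, ${}^x$ is an antitone involution on the interval $[x,1]$ such that $([x,1],\leq,{}^x,x,1)$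 is a paraorthomodular poset. A poset is mub-complete if for every finite subset $M$ and every upper bound $x$ of $M$ there is a minimal upper bound of $M$ below (or equal to) $x$. *)

theory Defs
  imports "HOL-Library.Lub_Glb"
begin

text \<open>
  The poset of the theorem is a type \<open>'a\<close> of class \<^class>\<open>order\<close>, with \<open>0\<close> and \<open>1\<close> rendered as
  \<^const>\<open>bot\<close> and \<^const>\<open>top\<close>. Notions that are also needed for the intervals \<open>[x, 1]\<close> take an
  explicit carrier set. The set of common upper bounds \<open>U(x, y)\<close> is \<^term>\<open>ubs UNIV {x, y}\<close>, and
  suprema and infima that need not exist are expressed by \<^const>\<open>isLub\<close> and \<^const>\<open>isGlb\<close>.
\<close>

definition minimal_elements :: "'a::order set \<Rightarrow> 'a set" where
  "minimal_elements A = {m \<in> A. \<not> (\<exists>a\<in>A. a < m)}"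

text \<open>The relation \<open>A \<le> B\<close> between subsets of a poset (on sets, \<open>\<le>\<close> itself means inclusion).\<close>

definition all_le :: "'a::order set \<Rightarrow> 'a set \<Rightarrow> bool" where
  "all_le A B \<longleftrightarrow> (\<forall>a\<in>A. \<forall>b\<in>B. a \<le> b)"

definition antitone_involution_on :: "'a::order set \<Rightarrow> ('a \<Rightarrow> 'a) \<Rightarrow> bool" where
  "antitone_involution_on Q f \<longleftrightarrow>
     (\<forall>x\<in>Q. f x \<in> Q) \<and>
     (\<forall>x\<in>Q. f (f x) = x) \<and>
     (\<forall>x\<in>Q. \<forall>y\<in>Q. x \<le> y \<longrightarrow> f y \<le> f x)"

definition paraorthomodular_on :: "'a::order set \<Rightarrow> ('a \<Rightarrow> 'a) \<Rightarrow> 'a \<Rightarrow> 'a \<Rightarrow> bool" where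
  "paraorthomodular_on Q f zero one \<longleftrightarrow>
     zero \<in> Q \<and> one \<in> Q \<and> (\<forall>x\<in>Q. zero \<le> x \<and> x \<le> one) \<and>
     antitone_involution_on Q f \<and>
     (\<forall>x\<in>Q. \<forall>y\<in>Q. x \<le> y \<and> isGlb Q {f x, y} zero \<longrightarrow> x = y)"

text \<open>
  The value \<open>w\<^sup>z\<close> of the involution on \<open>[z, 1]\<close> is \<^term>\<open>rinv z w\<close>; only its values for
  \<open>z \<le> w\<close> are constrained.
\<close>

definition relatively_paraorthomodular :: "('a::{order_bot,order_top} \<Rightarrow> 'a \<Rightarrow> 'a) \<Rightarrow> bool" where
  "relatively_paraorthomodular rinv \<longleftrightarrow> (\<forall>z. paraorthomodular_on {z..top} (rinv z) z top)"

definition mub_complete :: "'a::order set \<Rightarrow> bool" where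
  "mub_complete P \<longleftrightarrow>
     (\<forall>M x. finite M \<and> M \<subseteq> P \<and> isUb P M x \<longrightarrow> (\<exists>m \<in> minimal_elements (ubs P M). m \<le> x))"

definition arrow :: "('a::order \<Rightarrow> 'a \<Rightarrow> 'a) \<Rightarrow> 'a \<Rightarrow> 'a \<Rightarrow> 'a set" where
  "arrow rinv x y = rinv y ` minimal_elements (ubs UNIV {x, y})"

definition arrow_sets :: "('a::order \<Rightarrow> 'a \<Rightarrow> 'a) \<Rightarrow> 'a set \<Rightarrow> 'a set \<Rightarrow> 'a set" where
  "arrow_sets rinv A B = (\<Union>a\<in>A. \<Union>b\<in>B. arrow rinv a b)"

end

theory Submission
  imports Defs
begin

text \<open>
  Everything rests on the fact that \<open>Min U(a, y) = {a}\<close> for \<open>y \<le> a\<close>, so that \<open>a \<rightarrow> y\<close> is the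
  singleton of \<open>a\<^sup>y\<close>. As \<open>x \<rightarrow> y\<close> lies above \<open>y\<close>, applying \<open>\<rightarrow> y\<close> again just undoes the
  involution. Mub-completeness makes \<open>Min U(x, y)\<close> nonempty.
\<close>

lemma mem_ubs_pair_iff: "w \<in> ubs UNIV {a, b} \<longleftrightarrow> a \<le> w \<and> b \<le> w"
  by (simp add: ubs_def isUb_def setle_def)

lemma minimal_elements_least:
  assumes "m \<in> A" and "\<And>a. a \<in> A \<Longrightarrow> m \<le> a"
  shows "minimal_elements A = {m}"
  using assms unfolding minimal_elements_def by (auto simp: less_le_not_le antisym)

text \<open>A supremum is the least element of \<open>U(x, y)\<close>, hence its only minimal one.
  Both comparable cases follow, the larger element being the supremum.\<close>

lemma arrow_isLub:
  assumes "isLub UNIV {x, y} s"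
  shows "arrow rinv x y = {rinv y s}"
proof -
  have "minimal_elements (ubs UNIV {x, y}) = {s}"
  proof (rule minimal_elements_least)
    show "s \<in> ubs UNIV {x, y}"
      by (simp add: ubs_def isLub_isUb[OF assms])
    show "s \<le> w" if "w \<in> ubs UNIV {x, y}" for w
      using that by (simp add: ubs_def isLub_le_isUb[OF assms])
  qed
  then show ?thesis
    by (simp add: arrow_def)
qed

lemma arrow_above:
  assumes "y \<le> x"
  shows "arrow rinv x y = {rinv y x}"
  using assms
  by (intro arrow_isLub) (auto simp: isLub_def leastP_def isUb_def setle_def setge_def)

lemma arrow_sets_above:
  assumes "\<And>a. a \<in> A \<Longrightarrow> y \<le> a"
  shows "arrow_sets rinv A {y} = rinv y ` A"
  using assms by (auto simp: arrow_sets_def arrow_above)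

lemma arrow_le:
  assumes "x \<le> y"
  shows "arrow rinv x y = {rinv y y}"
  using assms
  by (intro arrow_isLub) (auto simp: isLub_def leastP_def isUb_def setle_def setge_def)

text \<open>Antitony turns \<open>y \<le> f top\<close> into \<open>f (f top) \<le> f y\<close>, and
  the left side is \<open>top\<close>.\<close>

lemma antitone_involution_on_bottom:
  fixes y :: "'a::order_top"
  assumes "antitone_involution_on {y..top} f"
  shows "f y = top"
proof -
  have "y \<le> f top" "f (f top) = top"
    using assms by (auto simp: antitone_involution_on_def)
  then show ?thesis
    using assms unfolding antitone_involution_on_def
    by (metis atLeastAtMost_iff order_refl top_greatest top_le)
qed

theorem theorem5p3:
  fixes rinv :: "'a::{order_bot,order_top} \<Rightarrow> 'a \<Rightarrow> 'a"
    and x y :: 'a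
  assumes "relatively_paraorthomodular rinv"
    and "mub_complete (UNIV :: 'a set)"
  shows "all_le {y} (arrow rinv x y) \<and>
    (x \<le> y \<longleftrightarrow> arrow rinv x y = {top}) \<and>
    ((x \<le> y \<longrightarrow> arrow rinv x y = {top}) \<and>
     (\<forall>s. isLub UNIV {x, y} s \<longrightarrow> arrow rinv x y = {rinv y s}) \<and>
     (y \<le> x \<longrightarrow> arrow rinv x y = {rinv y x})) \<and>
    arrow_sets rinv (arrow rinv x y) {y} = minimal_elements (ubs UNIV {x, y}) \<and>
    arrow_sets rinv (arrow_sets rinv (arrow rinv x y) {y}) {y} = arrow rinv x y"
proof -
  define W where "W = minimal_elements (ubs UNIV {x, y})"
  have inv: "antitone_involution_on {y..top} (rinv y)"
    using assms(1) by (simp add: relatively_paraorthomodular_def paraorthomodular_on_def)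
  have closed: "y \<le> rinv y w" and invol: "rinv y (rinv y w) = w" if "y \<le> w" for w
    using inv that by (auto simp: antitone_involution_on_def)
  have bottom: "rinv y y = top"
    by (rule antitone_involution_on_bottom[OF inv])
  have W: "x \<le> w" "y \<le> w" if "w \<in> W" for w
    using that by (auto simp: W_def minimal_elements_def mem_ubs_pair_iff)
  have arrow: "arrow rinv x y = rinv y ` W"
    by (simp add: arrow_def W_def)
  \<comment> \<open>Mub-completeness, applied to the upper bound \<open>top\<close>, supplies the
    witness \<open>w\<close> for the converse direction of (ii).\<close>
  have "isUb UNIV {x, y} top"
    by (simp add: isUb_def setle_def)
  moreover have "\<exists>m\<in>W. m \<le> u" if "isUb UNIV {x, y} u" for u
    using assms(2)[unfolded mub_complete_def, rule_format, of "{x, y}" u] that by (simp add: W_def)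
  ultimately obtain w where w: "w \<in> W"
    by auto
  have le: "x \<le> y" if "arrow rinv x y = {top}"
  proof -
    \<comment> \<open>Both sides are \<open>top\<close>. The involution is injective on
      \<open>[y, 1]\<close>, so \<open>w\<close> is \<open>y\<close> itself, and \<open>w\<close>
      lies above \<open>x\<close>.\<close>
    have "rinv y w = rinv y y"
      using that imageI[OF w, of "rinv y"] unfolding arrow bottom by simp
    then have "w = y"
      using invol[OF W(2)[OF w]] invol[of y] by simp
    then show ?thesis
      using W(1)[OF w] by simp
  qed
  have iv: "arrow_sets rinv (arrow rinv x y) {y} = W"
  proof -
    \<comment> \<open>By \<open>closed\<close>, the involution keeps the elements of
      \<open>W\<close> above \<open>y\<close>, so the outer arrow acts elementwise as a second
      involution.\<close>
    have "arrow_sets rinv (arrow rinv x y) {y} = rinv y ` rinv y ` W"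
      unfolding arrow by (rule arrow_sets_above) (auto intro: closed W)
    also have "\<dots> = W"
      by (simp add: image_image invol W)
    finally show ?thesis .
  qed
  \<comment> \<open>By (iv) the inner double arrow of (v) is \<open>W\<close>, so one more arrow
    remains to be computed.\<close>
  have v: "arrow_sets rinv W {y} = arrow rinv x y"
    unfolding arrow by (rule arrow_sets_above) (rule W)
  have i: "all_le {y} (arrow rinv x y)"
    by (auto simp: all_le_def arrow intro: closed W)
  have ii: "x \<le> y \<longleftrightarrow> arrow rinv x y = {top}"
    using arrow_le[of x y rinv] le unfolding bottom by (rule iffI)
  have iii: "(x \<le> y \<longrightarrow> arrow rinv x y = {top}) \<and>
      (\<forall>s. isLub UNIV {x, y} s \<longrightarrow> arrow rinv x y = {rinv y s}) \<and>
      (y \<le> x \<longrightarrow> arrow rinv x y = {rinv y x})"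
    using ii arrow_isLub[of x y _ rinv] arrow_above[of y x rinv] by iprover
  show ?thesis
    unfolding W_def[symmetric] iv v
    by (rule conjI[OF i conjI[OF ii conjI[OF iii conjI[OF refl refl]]]])
qed

end
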